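(* For $n\ge0$ let $s_n=\mathrm{ct}\left[(x^{-1}+1+x)^n(1+x)\right]$ and $R_n=\mathrm{ct}\left[(x^{-1}+1+x)^n(1-x)\right]$. Then for every prime $p$, the asymptotic densities of $0$ in the sequences $(s_n\bmod p)_{n\in\mathbb{N}}$ and $(R_n\bmod p)_{n\in\mathbb{N}}$ are equal.
   Context: For a Laurent polynomial $Q(x)$, $\mathrm{ct}[Q(x)]$ denotes its constant term. The sequence $s_n$ is OEIS A005773 and $R_n$ (the Riordan numbers) is OEIS A005043. The asymptotic density of a set $S\subseteq\mathbb{N}=\{0,1,2,\dots\}$ is $\lim_{N\to\infty}\frac{|S\cap\{n\in\mathbb{N}: n<N\}|}{N}$; the density of a value $x\in\mathbb{F}_p$ in a sequence $(c_n)$ over $\mathbb{F}_p$ is the asymptotic density of $\{n\in\mathbb{N}: c_n=x\}$. *)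

theory Defs
  imports Complex_Main "HOL-Computational_Algebra.Formal_Laurent_Series"
    "HOL-Computational_Algebra.Primes"
begin

text \<open>
  Laurent polynomials over the integers are regarded as elements of the ring of formal
  Laurent series; all series occurring below have finite support.
\<close>

definition ct :: "'a::zero fls \<Rightarrow> 'a" where
  "ct Q = fls_nth Q 0"

definition s_seq :: "nat \<Rightarrow> int" where
  "s_seq n = ct ((fls_X_inv + 1 + fls_X) ^ n * (1 + fls_X))"

definition Riordan :: "nat \<Rightarrow> int" where
  "Riordan n = ct ((fls_X_inv + 1 + fls_X) ^ n * (1 - fls_X))"

text \<open>A relation rather than a function, so that existence of the limit is part of the claim.\<close>

definition has_asymptotic_density :: "nat set \<Rightarrow> real \<Rightarrow> bool" where
  "has_asymptotic_density S d \<longleftrightarrow>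
     (\<lambda>N. real (card (S \<inter> {n. n < N})) / real N) \<longlonglongrightarrow> d"

definition has_value_density :: "(nat \<Rightarrow> 'a) \<Rightarrow> 'a \<Rightarrow> real \<Rightarrow> bool" where
  "has_value_density c x d \<longleftrightarrow> has_asymptotic_density {n. c n = x} d"

end

theory Submission
  imports Defs "HOL-Number_Theory.Residues"
begin

text \<open>
  Let \<open>T n\<close> be the central trinomial coefficient. For odd \<open>p\<close>, up to the unit 2 and sign, the two
  sequences are \<open>c y n = y * T n + T (n + 1)\<close> with \<open>y = 1\<close> and \<open>y = -3\<close>. The Lucas congruence
  \<open>T (p m + k) = T k * T m\<close> gives \<open>c y (p m + k) = c y k * T m\<close> for \<open>k < p - 1\<close> and
  \<open>c y (p m + p - 1) = c (y * T (p - 1)) m\<close>. The three-term recurrence of \<open>T\<close> yields the reflection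
  \<open>(-3) ^ k * T (p - 1 - k) = T (p - 1) * T k\<close>, so that whenever \<open>y * y' = -3\<close> the digits
  \<open>k < p - 1\<close> with \<open>c y k = 0\<close> and those with \<open>c y' k = 0\<close> are equinumerous. Hence the zero
  sets of \<open>c y\<close> and \<open>c y'\<close> have equal density outside the residue class of \<open>p - 1\<close>, and on this
  class the same situation recurs at scale \<open>1 / p\<close>. The densities exist because, again by the Lucas
  congruence, the zero set of \<open>T\<close> modulo \<open>p\<close> is empty or has density 1. For \<open>p = 2\<close> the two
  sequences agree.
\<close>

subsection \<open>Asymptotic density via sections modulo \<open>p\<close>\<close>

text \<open>This says \<open>limsup \<bar>card (S \<inter> {n. n < N}) / N - d\<bar> \<le> e\<close>; the additive constant lets the bounds for
  the sections of \<open>S\<close> be added up for all \<open>N\<close> simultaneously.\<close>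

definition near_density :: "nat set \<Rightarrow> real \<Rightarrow> real \<Rightarrow> bool" where
  "near_density S d e \<longleftrightarrow>
     (\<forall>\<delta>>0. \<exists>C. \<forall>N. \<bar>real (card (S \<inter> {n. n < N})) - d * real N\<bar> \<le> (e + \<delta>) * real N + C)"

lemma near_density_mono:
  assumes "near_density S d e" "e \<le> e'"
  shows "near_density S d e'"
  unfolding near_density_def
proof (intro allI impI)
  fix \<delta> :: real assume "\<delta> > 0"
  then obtain C where "\<forall>N. \<bar>real (card (S \<inter> {n. n < N})) - d * real N\<bar> \<le> (e + \<delta>) * real N + C"
    using assms(1) unfolding near_density_def by blast
  moreover have "(e + \<delta>) * real N \<le> (e' + \<delta>) * real N" for N
    using assms(2) by (intro mult_right_mono) auto
  ultimately show "\<exists>C. \<forall>N. \<bar>real (card (S \<inter> {n. n < N})) - d * real N\<bar> \<le> (e' + \<delta>) * real N + C"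
    by (meson add_right_mono order_trans)
qed

lemma near_density_limit:
  assumes "\<And>\<epsilon>. \<epsilon> > 0 \<Longrightarrow> near_density S d \<epsilon>"
  shows "near_density S d 0"
  unfolding near_density_def
proof (intro allI impI)
  fix \<delta> :: real assume "\<delta> > 0"
  then show "\<exists>C. \<forall>N. \<bar>real (card (S \<inter> {n. n < N})) - d * real N\<bar> \<le> (0 + \<delta>) * real N + C"
    using assms[of "\<delta> / 2", unfolded near_density_def, rule_format, of "\<delta> / 2"] by simp
qed

lemma near_density_empty: "near_density {} 0 0"
  unfolding near_density_def by (auto intro!: exI[of _ 0])

lemma near_density_UNIV: "near_density UNIV 1 0"
  unfolding near_density_def by (auto intro!: exI[of _ 0])

lemma card_Int_lessThan_le: "card (S \<inter> {n::nat. n < N}) \<le> N"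
  using card_mono[of "{n::nat. n < N}" "S \<inter> {n. n < N}"] by simp

text \<open>The proportion of \<open>S\<close> below \<open>N\<close> and \<open>d\<close> both lie
  in the unit interval. This starts the iterations in which the error shrinks geometrically.\<close>

lemma near_density_trivial:
  assumes "d \<in> {0..1}"
  shows "near_density S d 1"
  unfolding near_density_def
proof (intro allI impI exI[of _ 0])
  fix \<delta> :: real and N :: nat assume "\<delta> > 0"
  have "0 \<le> d * real N" "d * real N \<le> 1 * real N" "0 \<le> \<delta> * real N"
    using assms \<open>\<delta> > 0\<close> by (auto intro!: mult_right_mono mult_left_le_one_le)
  moreover have "real (card (S \<inter> {n. n < N})) \<le> real N"
    using card_Int_lessThan_le by simp
  ultimately show "\<bar>real (card (S \<inter> {n. n < N})) - d * real N\<bar> \<le> (1 + \<delta>) * real N + 0"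
    by (simp add: algebra_simps abs_le_iff)
qed

text \<open>The quotient is the ceiling of \<open>(N - k) / p\<close>; adding \<open>p\<close> first
  keeps the subtraction on naturals from truncating.\<close>

lemma less_div_iff_mult_add_less:
  fixes p :: nat
  assumes "k < p"
  shows "m < (N + p - Suc k) div p \<longleftrightarrow> p * m + k < N"
proof -
  have "m < (N + p - Suc k) div p \<longleftrightarrow> Suc m * p \<le> N + p - Suc k"
    using assms by (subst less_eq_div_iff_mult_less_eq[symmetric]) auto
  also have "\<dots> \<longleftrightarrow> p * m + k < N" using assms by (auto simp: algebra_simps)
  finally show ?thesis .
qed

lemma card_sections:
  fixes p :: nat
  assumes "p > 0"
  shows "card (S \<inter> {n. n < N}) =
    (\<Sum>k<p. card ({m. p * m + k \<in> S} \<inter> {m. m < (N + p - Suc k) div p}))"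
proof -
  let ?A = "\<lambda>k. {m. p * m + k \<in> S} \<inter> {m. m < (N + p - Suc k) div p}"
  have "S \<inter> {n. n < N} = (\<Union>k\<in>{..<p}. (\<lambda>m. p * m + k) ` ?A k)"
  proof (intro equalityI subsetI)
    fix n assume "n \<in> S \<inter> {n. n < N}"
    moreover from this have "n = p * (n div p) + n mod p" "n mod p < p" using assms by auto
    moreover from calculation have "n div p \<in> ?A (n mod p)"
      by (simp add: less_div_iff_mult_add_less)
    ultimately show "n \<in> (\<Union>k\<in>{..<p}. (\<lambda>m. p * m + k) ` ?A k)" by blast
  qed (auto simp: less_div_iff_mult_add_less)
  moreover have "card (\<Union>k\<in>{..<p}. (\<lambda>m. p * m + k) ` ?A k) =
      (\<Sum>k<p. card ((\<lambda>m. p * m + k) ` ?A k))"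
  proof (rule card_UN_disjoint)
    show "\<forall>i\<in>{..<p}. \<forall>j\<in>{..<p}. i \<noteq> j \<longrightarrow>
        (\<lambda>m. p * m + i) ` ?A i \<inter> (\<lambda>m. p * m + j) ` ?A j = {}"
    proof (intro ballI impI)
      fix i j assume "i \<in> {..<p}" "j \<in> {..<p}" "i \<noteq> j"
      then have "(p * m + i) mod p \<noteq> (p * m' + j) mod p" for m m' by simp
      then have "p * m + i \<noteq> p * m' + j" for m m' by metis
      then show "(\<lambda>m. p * m + i) ` ?A i \<inter> (\<lambda>m. p * m + j) ` ?A j = {}" by blast
    qed
  qed auto
  moreover have "card ((\<lambda>m. p * m + k) ` ?A k) = card (?A k)" for k
    using assms by (intro card_image) (auto simp: inj_on_def)
  ultimately show ?thesis by simp
qed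

text \<open>Each residue class has \<open>N / p\<close> elements below \<open>N\<close> up to an
  error of at most 1, so the densities and errors of the sections are averaged.\<close>

lemma near_density_sections:
  fixes p :: nat
  assumes "p > 0"
    and sec: "\<And>k. k < p \<Longrightarrow> near_density {m. p * m + k \<in> S} (d k) (e k)"
  shows "near_density S ((\<Sum>k<p. d k) / p) ((\<Sum>k<p. e k) / p)"
  unfolding near_density_def
proof (intro allI impI)
  fix \<delta> :: real assume \<delta>: "\<delta> > 0"
  let ?c = "\<lambda>k M. real (card ({m. p * m + k \<in> S} \<inter> {m. m < M}))"
  have "\<forall>k\<in>{..<p}. \<exists>C. \<forall>N. \<bar>?c k N - d k * real N\<bar> \<le> (e k + \<delta>) * real N + C"
    using sec \<delta> unfolding near_density_def by simp
  then obtain C where C: "\<And>k N. k < p \<Longrightarrow> \<bar>?c k N - d k * real N\<bar> \<le> (e k + \<delta>) * real N + C k"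
    by (metis lessThan_iff)
  show "\<exists>C. \<forall>N. \<bar>real (card (S \<inter> {n. n < N})) - (\<Sum>k<p. d k) / p * real N\<bar>
      \<le> ((\<Sum>k<p. e k) / p + \<delta>) * real N + C"
  proof (intro exI allI)
    fix N
    define M where "M k = (N + p - Suc k) div p" for k
    define x where "x = real N / real p"
    have M: "\<bar>real (M k) - x\<bar> \<le> 1" if "k < p" for k
    proof -
      have "p * M k \<le> N + p - Suc k" unfolding M_def by simp
      moreover have "N + p - Suc k < p * M k + p"
        using assms(1) dividend_less_times_div[of p "N + p - Suc k"] by (simp add: M_def add.commute)
      ultimately have "p * M k \<le> N + p" "N \<le> p * M k + p" using that by linarith+
      then have "real p * real (M k) \<le> real N + real p" "real N \<le> real p * real (M k) + real p"
        by (simp_all flip: of_nat_mult of_nat_add)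
      then show ?thesis using assms(1) by (simp add: x_def abs_le_iff field_simps)
    qed
    \<comment> \<open>Replacing \<open>M k\<close> by \<open>x\<close> costs at most
      \<open>\<bar>d k\<bar> + \<bar>e k + \<delta>\<bar>\<close>, which does not depend on
      \<open>N\<close> and goes into the constant.\<close>
    have single: "\<bar>?c k (M k) - d k * x\<bar> \<le> (e k + \<delta>) * x + (\<bar>e k + \<delta>\<bar> + C k + \<bar>d k\<bar>)"
      if "k < p" for k
    proof -
      have "\<bar>d k * (real (M k) - x)\<bar> \<le> \<bar>d k\<bar>"
        using M[OF that] by (simp add: abs_mult mult_left_le)
      moreover have "\<bar>(e k + \<delta>) * (real (M k) - x)\<bar> \<le> \<bar>e k + \<delta>\<bar>"
        using M[OF that] by (simp add: abs_mult mult_left_le)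
      ultimately show ?thesis using C[OF that, of "M k"] by (simp add: algebra_simps)
    qed
    have "real (card (S \<inter> {n. n < N})) - (\<Sum>k<p. d k) / p * real N = (\<Sum>k<p. ?c k (M k) - d k * x)"
      unfolding card_sections[OF assms(1), of S N] M_def x_def
      by (simp add: sum_subtractf flip: sum_distrib_right sum_divide_distrib)
    also have "\<bar>\<dots>\<bar> \<le> (\<Sum>k<p. (e k + \<delta>) * x + (\<bar>e k + \<delta>\<bar> + C k + \<bar>d k\<bar>))"
      using single by (intro order_trans[OF sum_abs] sum_mono) auto
    also have "\<dots> = ((\<Sum>k<p. e k) + real p * \<delta>) * x + (\<Sum>k<p. \<bar>e k + \<delta>\<bar> + C k + \<bar>d k\<bar>)"
      by (simp add: sum.distrib flip: sum_distrib_right)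
    also have "((\<Sum>k<p. e k) + real p * \<delta>) * x = ((\<Sum>k<p. e k) / p + \<delta>) * real N"
      using assms(1) by (simp add: x_def field_simps)
    finally show "\<bar>real (card (S \<inter> {n. n < N})) - (\<Sum>k<p. d k) / p * real N\<bar>
      \<le> ((\<Sum>k<p. e k) / p + \<delta>) * real N + (\<Sum>k<p. \<bar>e k + \<delta>\<bar> + C k + \<bar>d k\<bar>)" .
  qed
qed

section \<open>From approximate densities to limits\<close>

lemma near_density_eventually:
  assumes "near_density S d \<epsilon>" "\<epsilon> > 0"
  shows "\<forall>\<^sub>F N in sequentially. \<bar>real (card (S \<inter> {n. n < N})) / real N - d\<bar> \<le> 2 * \<epsilon>"
proof -
  \<comment> \<open>The slack is taken as \<open>\<epsilon> / 2\<close>; the remaining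
    \<open>\<epsilon> / 2\<close> absorbs \<open>C\<close> once \<open>N\<close> is at least
    \<open>2 * C / \<epsilon>\<close>.\<close>
  obtain C where C: "\<And>N. \<bar>real (card (S \<inter> {n. n < N})) - d * real N\<bar> \<le> (\<epsilon> + \<epsilon> / 2) * real N + C"
    using assms unfolding near_density_def by (meson half_gt_zero)
  have "\<forall>\<^sub>F N in sequentially. real N \<ge> 2 * C / \<epsilon>"
    using filterlim_real_sequentially unfolding filterlim_at_top by blast
  then show ?thesis
    using eventually_gt_at_top[of 0]
  proof eventually_elim
    case (elim N)
    then have "C \<le> \<epsilon> / 2 * real N" using assms(2) by (simp add: field_simps)
    with C[of N] have "\<bar>real (card (S \<inter> {n. n < N})) - d * real N\<bar> \<le> 2 * \<epsilon> * real N"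
      by (simp add: algebra_simps)
    moreover have "real (card (S \<inter> {n. n < N})) / real N - d =
        (real (card (S \<inter> {n. n < N})) - d * real N) / real N"
      using elim by (simp add: field_simps)
    ultimately show ?case using elim by (simp add: abs_divide divide_le_eq)
  qed
qed

text \<open>As \<open>d\<close> may vary with \<open>\<epsilon>\<close>, no limit is given in
  advance: the proportions of \<open>S\<close> form a Cauchy sequence, and those of
  \<open>S'\<close> differ from them by a null sequence.\<close>

lemma common_density_if_near:
  assumes near: "\<And>\<epsilon>. \<epsilon> > 0 \<Longrightarrow> \<exists>d. near_density S d \<epsilon> \<and> near_density S' d \<epsilon>"
  shows "\<exists>d. has_asymptotic_density S d \<and> has_asymptotic_density S' d"
proof -
  define X where "X S N = real (card (S \<inter> {n. n < N})) / real N" for S :: "nat set" and N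
  have close: "\<exists>d. (\<forall>\<^sub>F N in sequentially. \<bar>X S N - d\<bar> < r / 2) \<and>
      (\<forall>\<^sub>F N in sequentially. \<bar>X S' N - d\<bar> < r / 2)" if "r > 0" for r
  proof -
    obtain d where "near_density S d (r / 5)" "near_density S' d (r / 5)"
      using near[of "r / 5"] \<open>r > 0\<close> by fastforce
    then have "\<forall>\<^sub>F N in sequentially. \<bar>X S N - d\<bar> \<le> 2 * (r / 5)"
      "\<forall>\<^sub>F N in sequentially. \<bar>X S' N - d\<bar> \<le> 2 * (r / 5)"
      unfolding X_def using \<open>r > 0\<close> by (intro near_density_eventually; simp)+
    then have "\<forall>\<^sub>F N in sequentially. \<bar>X S N - d\<bar> < r / 2"
      "\<forall>\<^sub>F N in sequentially. \<bar>X S' N - d\<bar> < r / 2"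
      using \<open>r > 0\<close> by (auto elim: eventually_mono)
    then show ?thesis by blast
  qed
  have "Cauchy (X S)"
  proof (rule CauchyI)
    fix r :: real assume "r > 0"
    then obtain d where "\<forall>\<^sub>F N in sequentially. \<bar>X S N - d\<bar> < r / 2" using close by blast
    then obtain N0 where N0: "\<And>N. N \<ge> N0 \<Longrightarrow> \<bar>X S N - d\<bar> < r / 2"
      unfolding eventually_sequentially by blast
    have "norm (X S m - X S n) < r" if "m \<ge> N0" "n \<ge> N0" for m n
      using N0[OF that(1)] N0[OF that(2)] unfolding real_norm_def by linarith
    then show "\<exists>M. \<forall>m\<ge>M. \<forall>n\<ge>M. norm (X S m - X S n) < r" by blast
  qed
  then obtain L where L: "X S \<longlonglongrightarrow> L" using real_Cauchy_convergent convergent_def by blast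
  have "(\<lambda>N. X S' N - X S N) \<longlonglongrightarrow> 0"
  proof (rule tendstoI)
    fix r :: real assume "r > 0"
    then obtain d where "\<forall>\<^sub>F N in sequentially. \<bar>X S N - d\<bar> < r / 2"
      "\<forall>\<^sub>F N in sequentially. \<bar>X S' N - d\<bar> < r / 2" using close by blast
    then show "\<forall>\<^sub>F N in sequentially. dist (X S' N - X S N) 0 < r"
      by eventually_elim (simp add: dist_real_def abs_if split: if_splits)
  qed
  from tendsto_add[OF this L] have "X S' \<longlonglongrightarrow> L" by simp
  with L show ?thesis unfolding has_asymptotic_density_def X_def by blast
qed

text \<open>The last section of a pair is again a pair of the family, so each unfolding divides the
  uncertainty about the common density by \<open>p\<close>.\<close>

lemma common_density_by_sections:
  fixes p :: nat and \<Phi> :: "nat set \<Rightarrow> nat set \<Rightarrow> bool"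
  assumes p: "p \<ge> 2"
    and low: "\<And>S S'. \<Phi> S S' \<Longrightarrow> \<exists>d d'.
        (\<forall>k<p - 1. near_density {m. p * m + k \<in> S} (d k) 0) \<and>
        (\<forall>k<p - 1. near_density {m. p * m + k \<in> S'} (d' k) 0) \<and>
        (\<Sum>k<p - 1. d k) = (\<Sum>k<p - 1. d' k)"
    and top: "\<And>S S'. \<Phi> S S' \<Longrightarrow> \<Phi> {m. p * m + (p - 1) \<in> S} {m. p * m + (p - 1) \<in> S'}"
    and \<Phi>: "\<Phi> S S'"
  shows "\<exists>d. has_asymptotic_density S d \<and> has_asymptotic_density S' d"
proof -
  \<comment> \<open>Only the section of \<open>p - 1\<close> carries an error, so averaging over the
    \<open>p\<close> sections divides it by \<open>p\<close>.\<close>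
  have step: "near_density S (((\<Sum>k<p - 1. d k) + c) / p) (\<epsilon> / p)"
    if "\<forall>k<p - 1. near_density {m. p * m + k \<in> S} (d k) 0"
      and "near_density {m. p * m + (p - 1) \<in> S} c \<epsilon>" for S d c \<epsilon>
  proof -
    define d' e' where "d' k = (if k = p - 1 then c else d k)" and "e' k = (if k = p - 1 then \<epsilon> else 0)" for k
    have "near_density {m. p * m + k \<in> S} (d' k) (e' k)" if "k < p" for k
      using that \<open>near_density {m. p * m + (p - 1) \<in> S} c \<epsilon>\<close>
        \<open>\<forall>k<p - 1. near_density {m. p * m + k \<in> S} (d k) 0\<close>
      by (cases "k = p - 1") (auto simp: d'_def e'_def)
    then have "near_density S ((\<Sum>k<p. d' k) / p) ((\<Sum>k<p. e' k) / p)"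
      using p by (intro near_density_sections) auto
    moreover have "{..<p} = insert (p - 1) {..<p - 1}" using p by auto
    then have "(\<Sum>k<p. d' k) = (\<Sum>k<p - 1. d k) + c" "(\<Sum>k<p. e' k) = \<epsilon>"
      by (auto simp: d'_def e'_def)
    ultimately show ?thesis by simp
  qed
  have iter: "\<exists>d. near_density S d ((1 / p) ^ J) \<and> near_density S' d ((1 / p) ^ J)" if "\<Phi> S S'" for S S' J
    using that
  proof (induction J arbitrary: S S')
    case 0
    then show ?case by (intro exI[of _ 0]) (auto intro: near_density_trivial)
  next
    case (Suc J)
    obtain c where c: "near_density {m. p * m + (p - 1) \<in> S} c ((1 / p) ^ J)"
      "near_density {m. p * m + (p - 1) \<in> S'} c ((1 / p) ^ J)"
      using Suc.IH[OF top[OF Suc.prems]] by blast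
    obtain d d' where d: "\<forall>k<p - 1. near_density {m. p * m + k \<in> S} (d k) 0"
        "\<forall>k<p - 1. near_density {m. p * m + k \<in> S'} (d' k) 0"
        "(\<Sum>k<p - 1. d k) = (\<Sum>k<p - 1. d' k)"
      using low[OF Suc.prems] by blast
    show ?case using step[OF d(1) c(1)] step[OF d(2) c(2)] d(3) by auto
  qed
  show ?thesis
  proof (rule common_density_if_near)
    fix \<epsilon> :: real assume "\<epsilon> > 0"
    then obtain J where "(1 / real p) ^ J < \<epsilon>"
      using real_arch_pow_inv[of \<epsilon> "1 / real p"] p by auto
    then show "\<exists>d. near_density S d \<epsilon> \<and> near_density S' d \<epsilon>"
      using iter[OF \<Phi>, of J] near_density_mono less_imp_le by blast
  qed
qed

subsection \<open>Trinomial coefficients\<close>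

text \<open>The inner binomial coefficients are divisible by \<open>p\<close>. Stating this as
  divisibility in an arbitrary commutative ring makes it applicable to integer Laurent
  series.\<close>

lemma prime_dvd_power_add_diff:
  fixes x y :: "'a::comm_ring_1"
  assumes "prime p"
  shows "of_nat p dvd (x + y) ^ p - x ^ p - y ^ p"
proof -
  have p: "p > 0" using assms prime_gt_0_nat by blast
  have "(x + y) ^ p = (\<Sum>k\<le>p. of_nat (p choose k) * x ^ k * y ^ (p - k))"
    by (rule binomial_ring)
  also have "{..p} = insert 0 (insert p {0<..<p})" using p by auto
  also have "(\<Sum>k\<in>\<dots>. of_nat (p choose k) * x ^ k * y ^ (p - k)) =
      y ^ p + x ^ p + (\<Sum>k\<in>{0<..<p}. of_nat (p choose k) * x ^ k * y ^ (p - k))"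
    using p by (simp add: add.assoc)
  finally have eq: "(x + y) ^ p - x ^ p - y ^ p =
      (\<Sum>k\<in>{0<..<p}. of_nat (p choose k) * x ^ k * y ^ (p - k))" by simp
  have "of_nat p dvd (of_nat (p choose k) :: 'a)" if "k \<in> {0<..<p}" for k
  proof -
    have "p dvd p choose k" using that assms by (intro dvd_choose_prime) auto
    then show ?thesis by (auto elim!: dvdE simp del: binomial_eq_0_iff)
  qed
  then show ?thesis unfolding eq by (intro dvd_sum dvd_mult2) auto
qed

lemma dvd_power_diff_power:
  fixes x y :: "'a::comm_ring_1"
  assumes "d dvd x - y"
  shows "d dvd x ^ n - y ^ n"
  using assms by (metis dvd_mult2 power_diff_sumr2)

lemma of_nat_dvd_fls_imp_dvd_nth:
  fixes F :: "int fls"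
  assumes "of_nat d dvd F"
  shows "int d dvd fls_nth F j"
  using assms by (auto simp: fls_of_nat elim!: dvdE)

definition trinom :: "nat \<Rightarrow> int \<Rightarrow> int" where
  "trinom n j = fls_nth ((fls_X_inv + 1 + fls_X) ^ n) j"

abbreviation central_trinom :: "nat \<Rightarrow> int" where
  "central_trinom n \<equiv> trinom n 0"

lemma trinom_0: "trinom 0 j = (if j = 0 then 1 else 0)"
  by (simp add: trinom_def)

lemma trinom_Suc: "trinom (Suc n) j = trinom n (j - 1) + trinom n j + trinom n (j + 1)"
  by (simp add: trinom_def ring_distribs fls_X_times_conv_shift fls_X_inv_times_conv_shift)

lemma trinom_uminus: "trinom n (- j) = trinom n j"
proof (induction n arbitrary: j)
  case (Suc n)
  have "- j - 1 = - (j + 1)" "- j + 1 = - (j - 1)" by simp_all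
  then show ?case by (simp only: trinom_Suc Suc.IH ac_simps)
qed (simp add: trinom_0)

lemma central_trinom_Suc: "central_trinom (Suc n) = central_trinom n + 2 * trinom n 1"
  using trinom_uminus[of n 1] by (simp add: trinom_Suc)

lemma s_seq_eq: "s_seq n = central_trinom n + trinom n 1"
  using trinom_uminus[of n 1]
  by (simp add: s_seq_def ct_def trinom_def ring_distribs fls_X_times_conv_shift)

lemma Riordan_eq: "Riordan n = central_trinom n - trinom n 1"
  using trinom_uminus[of n 1]
  by (simp add: Riordan_def ct_def trinom_def ring_distribs fls_X_times_conv_shift)

text \<open>This compares coefficients after applying \<open>x d/dx\<close> to the power
  \<open>Suc n\<close> of the trinomial, whose image under this derivation is
  \<open>x - 1/x\<close>. The proof needs no derivative, only induction with the Pascal-type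
  rule.\<close>

lemma trinom_euler: "j * trinom (Suc n) j = int (Suc n) * (trinom n (j - 1) - trinom n (j + 1))"
proof (induction n arbitrary: j)
  case 0
  show ?case by (auto simp: trinom_0 trinom_Suc)
next
  case (Suc n)
  have "j * trinom (Suc (Suc n)) j =
      (j - 1) * trinom (Suc n) (j - 1) + j * trinom (Suc n) j + (j + 1) * trinom (Suc n) (j + 1)
      + trinom (Suc n) (j - 1) - trinom (Suc n) (j + 1)"
    by (simp add: trinom_Suc[of "Suc n"] algebra_simps)
  also have "\<dots> = int (Suc n) * (trinom (Suc n) (j - 1) - trinom (Suc n) (j + 1))
      + trinom (Suc n) (j - 1) - trinom (Suc n) (j + 1)"
    unfolding Suc.IH by (simp add: trinom_Suc algebra_simps)
  finally show ?case by (simp add: algebra_simps)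
qed

text \<open>The off-centre coefficients are eliminated between \<open>trinom_euler\<close> at
  \<open>j = 1\<close> and the Pascal-type rule.\<close>

lemma central_trinom_recurrence:
  "(int n + 2) * central_trinom (Suc (Suc n)) =
     (2 * int n + 3) * central_trinom (Suc n) + 3 * (int n + 1) * central_trinom n"
proof -
  have a: "trinom (Suc n) 1 = int (Suc n) * (central_trinom n - trinom n 2)"
    using trinom_euler[of 1 n] by simp
  have b: "trinom (Suc n) 1 = central_trinom n + trinom n 1 + trinom n 2"
    using trinom_Suc[of n 1] by simp
  have c: "central_trinom (Suc n) = central_trinom n + 2 * trinom n 1"
    "central_trinom (Suc (Suc n)) = central_trinom (Suc n) + 2 * trinom (Suc n) 1"
    by (rule central_trinom_Suc)+
  have "trinom n 2 = trinom (Suc n) 1 - central_trinom n - trinom n 1" using b by simp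
  with a have "int (n + 2) * trinom (Suc n) 1 = int (n + 1) * (2 * central_trinom n + trinom n 1)"
    by (simp add: algebra_simps)
  then have "int (n + 2) * (2 * trinom (Suc n) 1) =
      int (n + 1) * (4 * central_trinom n + 2 * trinom n 1)"
    by (simp add: algebra_simps)
  with c show ?thesis by (simp add: algebra_simps)
qed

subsection \<open>Congruences\<close>

lemma trinomial_power_prime_cong:
  assumes "prime p"
  shows "of_nat p dvd (fls_X_inv + 1 + fls_X) ^ p - (fls_X_inv ^ p + 1 + fls_X ^ p :: int fls)"
proof -
  have "of_nat p dvd ((fls_X_inv + 1 + fls_X) ^ p - (fls_X_inv + 1) ^ p - fls_X ^ p)
      + ((fls_X_inv + 1) ^ p - fls_X_inv ^ p - (1 :: int fls) ^ p)"
    using assms by (intro dvd_add prime_dvd_power_add_diff)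
  then show ?thesis by (simp add: algebra_simps)
qed

text \<open>The base is the trinomial with \<open>x\<close> replaced by the \<open>p\<close>-th
  power of \<open>x\<close>, so its powers live on exponents divisible by \<open>p\<close>.\<close>

lemma fls_nth_stretched_trinomial_power:
  assumes "p > 0"
  shows "fls_nth ((fls_X_inv ^ p + 1 + fls_X ^ p) ^ m) j =
    (if int p dvd j then trinom m (j div int p) else 0)"
proof (induction m arbitrary: j)
  case 0
  then show ?case using assms by (auto simp: trinom_0 dvd_div_eq_0_iff)
next
  case (Suc m)
  have "fls_nth ((fls_X_inv ^ p + 1 + fls_X ^ p) ^ Suc m) j =
     (fls_nth ((fls_X_inv ^ p + 1 + fls_X ^ p) ^ m) (j + int p)) +
     (fls_nth ((fls_X_inv ^ p + 1 + fls_X ^ p) ^ m) j) +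
     (fls_nth ((fls_X_inv ^ p + 1 + fls_X ^ p) ^ m :: int fls) (j - int p))"
    by (simp add: ring_distribs fls_X_inv_power_times_conv_shift fls_X_power_times_conv_shift)
  then show ?case
    unfolding Suc.IH using assms
    by (auto simp: trinom_Suc elim!: dvdE) (simp_all add: algebra_simps)
qed

lemma trinom_mult_prime_cong:
  assumes "prime p"
  shows "[trinom (p * m) j = (if int p dvd j then trinom m (j div int p) else 0)] (mod int p)"
proof -
  have p: "p > 0" using assms(1) prime_gt_0_nat by blast
  let ?G = "(fls_X_inv ^ p + 1 + fls_X ^ p :: int fls) ^ m"
  have "of_nat p dvd ((fls_X_inv + 1 + fls_X) ^ p) ^ m - ?G"
    by (intro dvd_power_diff_power trinomial_power_prime_cong assms)
  from of_nat_dvd_fls_imp_dvd_nth[OF this, of j]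
  have "[trinom (p * m) j = fls_nth ?G j] (mod int p)"
    unfolding cong_iff_dvd_diff trinom_def power_mult fls_minus_nth .
  then show ?thesis by (simp only: fls_nth_stretched_trinomial_power[OF p])
qed

text \<open>Modulo \<open>p\<close>, the power \<open>p * m\<close> is supported on multiples of
  \<open>p\<close>. Position \<open>j\<close> sees only positions within distance \<open>k\<close>,
  and the bound on \<open>k\<close> and \<open>j\<close> leaves 0 as the only multiple in
  reach.\<close>

lemma trinom_lucas:
  assumes "prime p" "int k + \<bar>j\<bar> < int p"
  shows "[trinom (p * m + k) j = trinom k j * central_trinom m] (mod int p)"
  using assms(2)
proof (induction k arbitrary: j)
  case 0
  then have "int p dvd j \<longleftrightarrow> j = 0" using dvd_imp_le_int[of j "int p"] by force
  then show ?case
    using trinom_mult_prime_cong[OF assms(1), of m j] by (cases "j = 0") (simp_all add: trinom_0)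
next
  case (Suc k)
  have "[trinom (p * m + k) (j - 1) + trinom (p * m + k) j + trinom (p * m + k) (j + 1) =
     trinom k (j - 1) * central_trinom m + trinom k j * central_trinom m
     + trinom k (j + 1) * central_trinom m] (mod int p)"
    using Suc.prems by (intro cong_add Suc.IH) auto
  then show ?case by (simp add: trinom_Suc algebra_simps)
qed

lemma central_trinom_lucas:
  assumes "prime p" "k < p"
  shows "[central_trinom (p * m + k) = central_trinom k * central_trinom m] (mod int p)"
  using trinom_lucas[of p k 0 m] assms by simp


lemma central_trinom_0: "central_trinom 0 = 1"
  by (simp add: trinom_0)

lemma central_trinom_1: "central_trinom (Suc 0) = 1"
  by (simp add: trinom_0 trinom_Suc)

text \<open>Modulo \<open>p\<close>, both sides satisfy the three-term recurrence of the central trinomial coefficients.\<close>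

lemma central_trinom_reflect:
  assumes "prime p" "k < p"
  shows "[(-3) ^ k * central_trinom (p - 1 - k) = central_trinom (p - 1) * central_trinom k] (mod int p)"
  using assms(2)
proof (induction k rule: induct_nat_012)
  case 0
  then show ?case by (simp add: trinom_0)
next
  case 1
  then have n: "Suc (Suc (p - 2)) = p" "Suc (p - 2) = p - 1" "p - 1 - Suc 0 = p - 2" by auto
  \<comment> \<open>Modulo \<open>p\<close>, the recurrence at \<open>p - 2\<close> loses its left
    side, and its coefficients become -1 and -3.\<close>
  have "int p * central_trinom p =
      (2 * int p - 1) * central_trinom (p - 1) + 3 * (int p - 1) * central_trinom (p - 2)"
    using central_trinom_recurrence[of "p - 2"] 1 unfolding n(1,2)
    by (simp add: of_nat_diff algebra_simps)
  then have "- 3 * central_trinom (p - 2) - central_trinom (p - 1) =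
      int p * (central_trinom p - 2 * central_trinom (p - 1) - 3 * central_trinom (p - 2))"
    by (simp add: algebra_simps)
  then have "int p dvd - 3 * central_trinom (p - 2) - central_trinom (p - 1)" by simp
  then show ?case unfolding n(3) by (simp add: cong_iff_dvd_diff central_trinom_1)
next
  case (ge2 k)
  define q e w t where "q = int p" and "e = int k" and "w = (-3 :: int) ^ k"
    and "t = central_trinom (p - 1)"
  define A B C where "A = central_trinom (p - 1 - k)" and "B = central_trinom (p - 1 - Suc k)"
    and "C = central_trinom (p - 1 - Suc (Suc k))"
  define X Y Z where "X = central_trinom k" and "Y = central_trinom (Suc k)"
    and "Z = central_trinom (Suc (Suc k))"
  obtain n where n: "p = n + k + 3"
    using ge2.prems by (intro that[of "p - k - 3"]) auto
  have rec: "(q - 1 - e) * A = (2 * q - 2 * e - 3) * B + 3 * (q - 2 - e) * C"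
  proof -
    have "p - 1 - k = Suc (Suc n)" "p - 1 - Suc k = Suc n" "p - 1 - Suc (Suc k) = n"
      by (simp_all add: n)
    moreover have "q - 1 - e = int n + 2" "2 * q - 2 * e - 3 = 2 * int n + 3" "q - 2 - e = int n + 1"
      by (simp_all add: n q_def e_def)
    ultimately show ?thesis
      unfolding A_def B_def C_def by (simp only: central_trinom_recurrence)
  qed
  have rec': "(e + 2) * Z = (2 * e + 3) * Y + 3 * (e + 1) * X"
    unfolding X_def Y_def Z_def e_def by (rule central_trinom_recurrence)
  have IH: "q dvd w * A - t * X" "q dvd - 3 * w * B - t * Y"
    using ge2 by (simp_all add: cong_iff_dvd_diff q_def w_def t_def A_def B_def X_def Y_def)
  \<comment> \<open>Modulo \<open>q\<close>, the recurrence at \<open>p - 3 - k\<close> read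
    backwards and scaled by \<open>3 * w\<close> is \<open>rec'\<close> for the values
    \<open>w * A\<close>, \<open>- 3 * w * B\<close>, \<open>9 * w * C\<close>.\<close>
  have C: "9 * w * ((e + 2) * C) =
      3 * w * (e + 1) * A - 3 * w * (2 * e + 3) * B + q * (- 3 * w * A + 6 * w * B + 9 * w * C)"
    using arg_cong[OF rec, of "\<lambda>x. 3 * w * x"] by (simp add: algebra_simps)
  have "(e + 2) * (9 * w * C - t * Z) = 9 * w * ((e + 2) * C) - t * ((e + 2) * Z)"
    by (simp add: algebra_simps)
  also have "\<dots> = 3 * (e + 1) * (w * A - t * X) + (2 * e + 3) * (- 3 * w * B - t * Y)
      + q * (- 3 * w * A + 6 * w * B + 9 * w * C)"
    unfolding C rec' by (simp add: algebra_simps)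
  also have "q dvd \<dots>" using IH by (intro dvd_add) auto
  finally have "q dvd (e + 2) * (9 * w * C - t * Z)" .
  \<comment> \<open>As \<open>k + 2 < p\<close>, the leading coefficient can be cancelled.\<close>
  moreover have "\<not> q dvd e + 2"
    using zdvd_not_zless[of "e + 2" q] by (simp add: q_def e_def n)
  moreover have "prime q" using assms(1) by (simp add: q_def)
  ultimately have "q dvd 9 * w * C - t * Z" by (metis prime_dvd_mult_iff)
  then show ?case by (simp add: cong_iff_dvd_diff q_def w_def C_def t_def Z_def)
qed

text \<open>Reflection at \<open>k = p - 1\<close> makes the square of this coefficient congruent to
  a power of -3.\<close>

lemma not_dvd_central_trinom_pred:
  assumes "prime p" "p \<noteq> 3"
  shows "\<not> int p dvd central_trinom (p - 1)"
proof
  assume "int p dvd central_trinom (p - 1)"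
  moreover have "[(-3) ^ (p - 1) = central_trinom (p - 1) * central_trinom (p - 1)] (mod int p)"
    using central_trinom_reflect[OF assms(1), of "p - 1"] prime_gt_0_nat[OF assms(1)]
    by (simp add: central_trinom_0)
  ultimately have "int p dvd (-3) ^ (p - 1)" by (metis cong_dvd_iff dvd_mult)
  then have "int p dvd -3" using assms(1) by (metis prime_dvd_power prime_nat_int_transfer)
  then have "p dvd 3" by (metis dvd_minus_iff of_nat_dvd_iff of_nat_numeral)
  then show False using assms primes_dvd_imp_eq[of p 3] by auto
qed

text \<open>Reflection at \<open>k = p - 1\<close> gives the power \<open>p - 1\<close> of -3; this
  is 1 by Fermat's little theorem, the exponent being even.\<close>

lemma central_trinom_pred_square:
  assumes "prime p" "p \<noteq> 2" "p \<noteq> 3"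
  shows "[central_trinom (p - 1) ^ 2 = 1] (mod int p)"
proof -
  have p: "p > 0" "even (p - 1)"
    using assms prime_gt_0_nat prime_odd_nat[of p] prime_ge_2_nat[of p] by auto
  have "\<not> p dvd 3" using assms primes_dvd_imp_eq[of p 3] by auto
  then have "[int (3 ^ (p - 1)) = int 1] (mod int p)"
    using fermat_theorem[OF assms(1), of 3] by (simp only: cong_int_iff) simp
  then have "[(-3) ^ (p - 1) = (1 :: int)] (mod int p)" using p by simp
  moreover have "[(-3) ^ (p - 1) = central_trinom (p - 1) ^ 2] (mod int p)"
    using central_trinom_reflect[OF assms(1), of "p - 1"] p
    by (simp add: central_trinom_0 power2_eq_square)
  ultimately show ?thesis by (metis cong_sym cong_trans)
qed

section \<open>Combinations of consecutive central trinomial coefficients\<close>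

definition trinom_comb :: "int \<Rightarrow> nat \<Rightarrow> int" where
  "trinom_comb y n = y * central_trinom n + central_trinom (Suc n)"

lemma trinom_comb_low_digit:
  assumes "prime p" "Suc k < p"
  shows "[trinom_comb y (p * m + k) = trinom_comb y k * central_trinom m] (mod int p)"
proof -
  have "[y * central_trinom (p * m + k) + central_trinom (p * m + Suc k) =
      y * (central_trinom k * central_trinom m) + central_trinom (Suc k) * central_trinom m] (mod int p)"
    using assms by (intro cong_add cong_mult cong_refl central_trinom_lucas) auto
  then show ?thesis by (simp add: trinom_comb_def algebra_simps)
qed

text \<open>Here the successor carries: \<open>p * m + p\<close> has last digit 0 and leading part
  \<open>Suc m\<close>. Only the first summand picks up the factor
  \<open>central_trinom (p - 1)\<close>, which amounts to changing \<open>y\<close>.\<close>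

lemma trinom_comb_top_digit:
  assumes "prime p"
  shows "[trinom_comb y (p * m + (p - 1)) = trinom_comb (y * central_trinom (p - 1)) m] (mod int p)"
proof -
  have p: "p > 0" using assms prime_gt_0_nat by blast
  have "[y * central_trinom (p * m + (p - 1)) + central_trinom (p * Suc m + 0) =
      y * (central_trinom (p - 1) * central_trinom m)
      + central_trinom 0 * central_trinom (Suc m)] (mod int p)"
    using assms p by (intro cong_add cong_mult cong_refl central_trinom_lucas) auto
  moreover have "p * Suc m + 0 = Suc (p * m + (p - 1))" using p by simp
  ultimately show ?thesis by (simp add: trinom_comb_def central_trinom_0 algebra_simps)
qed

text \<open>Reflection interchanges the two summands of the combination. With
  \<open>y * y' = -3\<close> the two values agree modulo \<open>p\<close> up to the factors 3,
  \<open>w\<close>, \<open>y\<close> and \<open>t\<close>, all units.\<close>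

lemma dvd_trinom_comb_reflect:
  assumes "prime p" "p \<noteq> 3" "[y * y' = -3] (mod int p)" "k < p - 1"
  shows "int p dvd trinom_comb y' (p - 1 - Suc k) \<longleftrightarrow> int p dvd trinom_comb y k"
proof -
  define t w where "t = central_trinom (p - 1)" and "w = (-3 :: int) ^ k"
  have q: "prime (int p)" using assms(1) by simp
  have "\<not> p dvd 3" using assms primes_dvd_imp_eq[of p 3] by auto
  then have 3: "\<not> int p dvd 3" "\<not> int p dvd -3" by (metis of_nat_dvd_iff of_nat_numeral dvd_minus_iff)+
  then have w: "\<not> int p dvd w" unfolding w_def using prime_dvd_power[OF q] by blast
  have t: "\<not> int p dvd t" unfolding t_def by (rule not_dvd_central_trinom_pred[OF assms(1,2)])
  have y: "\<not> int p dvd y" using assms(3) 3 by (metis cong_dvd_iff dvd_mult2)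
  have A: "[w * central_trinom (p - 1 - k) = t * central_trinom k] (mod int p)"
    using central_trinom_reflect[OF assms(1), of k] assms(4) by (simp add: w_def t_def)
  have B: "[- 3 * w * central_trinom (p - 1 - Suc k) = t * central_trinom (Suc k)] (mod int p)"
    using central_trinom_reflect[OF assms(1), of "Suc k"] assms(4) by (simp add: w_def t_def)
  have "- 3 * w * y * trinom_comb y' (p - 1 - Suc k) =
      (y * y') * (- 3 * w * central_trinom (p - 1 - Suc k))
      + - 3 * y * (w * central_trinom (Suc (p - 1 - Suc k)))"
    by (simp add: trinom_comb_def algebra_simps)
  also have "Suc (p - 1 - Suc k) = p - 1 - k" using assms(4) by simp
  also have "[(y * y') * (- 3 * w * central_trinom (p - 1 - Suc k))
      + - 3 * y * (w * central_trinom (p - 1 - k)) =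
      -3 * (t * central_trinom (Suc k)) + - 3 * y * (t * central_trinom k)] (mod int p)"
    by (intro cong_add cong_mult cong_refl A B assms(3))
  also have "-3 * (t * central_trinom (Suc k)) + - 3 * y * (t * central_trinom k)
      = - 3 * t * trinom_comb y k"
    by (simp add: trinom_comb_def algebra_simps)
  finally have "int p dvd - 3 * w * y * trinom_comb y' (p - 1 - Suc k) \<longleftrightarrow>
      int p dvd - 3 * t * trinom_comb y k"
    by (rule cong_dvd_iff)
  then show ?thesis using 3 w t y by (simp only: prime_dvd_mult_iff[OF q] simp_thms)
qed

subsection \<open>Zero sets\<close>

lemma cong_dvd_multiple_iff:
  fixes a b c :: int
  assumes "prime q" "[a = b * c] (mod q)"
  shows "q dvd a \<longleftrightarrow> q dvd b \<or> q dvd c"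
  using assms cong_dvd_iff prime_dvd_mult_iff by metis

text \<open>By the Lucas congruence, \<open>n\<close> lies in the zero set iff one of its base
  \<open>p\<close> digits does. If such a digit exists, almost every \<open>n\<close> contains
  it.\<close>

lemma near_density_dvd_central_trinom:
  assumes p: "prime p"
  shows "near_density {n. int p dvd central_trinom n}
    (if \<exists>k<p. int p dvd central_trinom k then 1 else 0) 0"
proof -
  let ?Z = "{n. int p dvd central_trinom n}"
  have p0: "p > 0" using p prime_gt_0_nat by blast
  have digit: "int p dvd central_trinom (p * m + k) \<longleftrightarrow>
      int p dvd central_trinom k \<or> int p dvd central_trinom m" if "k < p" for m k
    using central_trinom_lucas[OF p that] p by (intro cong_dvd_multiple_iff) auto
  show ?thesis
  proof (cases "\<exists>k<p. int p dvd central_trinom k")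
    case True
    then obtain k0 where k0: "k0 < p" "int p dvd central_trinom k0" by blast
    \<comment> \<open>The share of digits other than \<open>k0\<close>; further zero digits would
      only improve the bound.\<close>
    define r where "r = (real p - 1) / p"
    have r: "0 \<le> r" "r < 1" using p0 by (auto simp: r_def)
    have iter: "near_density ?Z 1 (r ^ J)" for J
    proof (induction J)
      case 0
      then show ?case by (simp add: near_density_trivial)
    next
      case (Suc J)
      let ?e = "\<lambda>k. if int p dvd central_trinom k then 0 else r ^ J"
      have "near_density {m. p * m + k \<in> ?Z} 1 (?e k)" if "k < p" for k
        using Suc near_density_UNIV by (simp add: digit[OF that])
      then have "near_density ?Z ((\<Sum>k<p. 1) / p) ((\<Sum>k<p. ?e k) / p)"
        by (rule near_density_sections[OF p0])
      moreover have "(\<Sum>k<p. ?e k) \<le> (\<Sum>k<p. if k = k0 then 0 else r ^ J)"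
        using k0 r by (intro sum_mono) auto
      moreover have "(\<Sum>k<p. if k = k0 then 0 else r ^ J) = (real p - 1) * r ^ J"
      proof -
        have "(\<Sum>k<p. if k = k0 then 0 else r ^ J) = (\<Sum>k\<in>{..<p} - {k0}. r ^ J)"
          using k0 by (intro sum.mono_neutral_cong_right) auto
        then show ?thesis using k0 by (simp add: of_nat_diff)
      qed
      ultimately show ?case
        using p0 by (auto simp: r_def divide_right_mono elim!: near_density_mono)
    qed
    have "near_density ?Z 1 0"
    proof (rule near_density_limit)
      fix \<epsilon> :: real assume "\<epsilon> > 0"
      then obtain J where "r ^ J < \<epsilon>" using r real_arch_pow_inv by blast
      then show "near_density ?Z 1 \<epsilon>" using iter near_density_mono less_imp_le by blast
    qed
    with True show ?thesis by simp
  next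
    case False
    have "\<not> int p dvd central_trinom n" for n
    proof (induction n rule: less_induct)
      case (less n)
      show ?case
      proof (cases "n < p")
        case True
        with False show ?thesis by blast
      next
        case ge: False
        then have "n div p < n" using prime_gt_1_nat[OF p] by (intro div_less_dividend) auto
        with less False p0 show ?thesis using digit[of "n mod p" "n div p"] by auto
      qed
    qed
    then have "?Z = {}" by blast
    with False show ?thesis using near_density_empty by simp
  qed
qed

text \<open>The relation \<open>y y' = -3\<close> survives replacing \<open>y, y'\<close> by \<open>y t, y' t\<close> with
  \<open>t = central_trinom (p - 1)\<close>, because \<open>t\<^sup>2 = 1\<close> modulo \<open>p\<close> (or \<open>p = 3\<close>), and it makes
  the digit reflection \<open>k \<mapsto> p - 2 - k\<close> exchange the two sets of digits with a vanishing value.\<close>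

lemma common_density_dvd_trinom_comb:
  assumes p: "prime p" "p \<noteq> 2" and "[y * y' = -3] (mod int p)"
  shows "\<exists>d. has_asymptotic_density {n. int p dvd trinom_comb y n} d \<and>
             has_asymptotic_density {n. int p dvd trinom_comb y' n} d"
proof -
  \<comment> \<open>The density of the zero set of \<open>central_trinom\<close>. A section of
    \<open>Z y\<close> at \<open>k < p - 1\<close> is everything if \<open>k\<close> is a zero
    digit, and otherwise that zero set.\<close>
  define \<tau> :: real where "\<tau> = (if \<exists>k<p. int p dvd central_trinom k then 1 else 0)"
  define Z where "Z y = {n. int p dvd trinom_comb y n}" for y
  define D where "D y k = (if int p dvd trinom_comb y k then 1 else \<tau>)" for y k
  define t where "t = central_trinom (p - 1)"
  define \<Phi> where "\<Phi> S S' \<longleftrightarrow> (\<exists>y y'. [y * y' = -3] (mod int p) \<and> S = Z y \<and> S' = Z y')" for S S'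
  have low: "near_density {m. p * m + k \<in> Z y} (D y k) 0" if "k < p - 1" for y k
  proof -
    have "int p dvd trinom_comb y (p * m + k) \<longleftrightarrow>
        int p dvd trinom_comb y k \<or> int p dvd central_trinom m" for m
      using trinom_comb_low_digit[of p k y m] p that by (intro cong_dvd_multiple_iff) auto
    then show ?thesis
      using near_density_dvd_central_trinom[OF p(1)] near_density_UNIV
      by (simp add: Z_def D_def \<tau>_def)
  qed
  have top: "{m. p * m + (p - 1) \<in> Z y} = Z (y * t)" for y
    unfolding Z_def t_def mem_Collect_eq cong_dvd_iff[OF trinom_comb_top_digit[OF p(1)]] ..
  have sums: "(\<Sum>k<p - 1. D y k) = (\<Sum>k<p - 1. D y' k)" if "[y * y' = -3] (mod int p)" for y y'
  proof (cases "p = 3")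
    case True
    \<comment> \<open>For \<open>p = 3\<close> reflection is degenerate, but all sections below the
      top digit have density 1.\<close>
    have "central_trinom 2 = 3" by (simp add: numeral_2_eq_2 trinom_Suc trinom_0)
    then have "\<tau> = 1" using True by (auto simp: \<tau>_def intro!: exI[of _ 2])
    then have "D z k = 1" for z k by (simp add: D_def)
    then show ?thesis by simp
  next
    case False
    have "(\<Sum>k<p - 1. D y k) = (\<Sum>k<p - 1. D y' (p - 1 - Suc k))"
      using dvd_trinom_comb_reflect[OF p(1) False that] by (intro sum.cong) (auto simp: D_def)
    then show ?thesis by (simp only: sum.nat_diff_reindex)
  qed
  have product: "[(y * t) * (y' * t) = -3] (mod int p)" if "[y * y' = -3] (mod int p)" for y y'
  proof (cases "p = 3")
    case True
    then have "[y * y' = 0] (mod 3)" using that by (simp add: cong_def)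
    then have "[(y * y') * t\<^sup>2 = 0 * t\<^sup>2] (mod 3)" by (intro cong_mult cong_refl)
    then show ?thesis using True by (simp add: cong_def power2_eq_square ac_simps)
  next
    case False
    have "[(y * y') * t\<^sup>2 = -3 * 1] (mod int p)"
      using that central_trinom_pred_square[OF p False] unfolding t_def by (intro cong_mult)
    then show ?thesis by (simp add: power2_eq_square ac_simps)
  qed
  have "\<exists>d. has_asymptotic_density (Z y) d \<and> has_asymptotic_density (Z y') d"
  proof (rule common_density_by_sections[where p = p and \<Phi> = \<Phi>])
    show "p \<ge> 2" using p(1) by (rule prime_ge_2_nat)
    show "\<Phi> (Z y) (Z y')" using assms(3) by (auto simp: \<Phi>_def)
    show "\<Phi> {m. p * m + (p - 1) \<in> S} {m. p * m + (p - 1) \<in> S'}" if "\<Phi> S S'" for S S'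
      using that product top unfolding \<Phi>_def by metis
    show "\<exists>d d'. (\<forall>k<p - 1. near_density {m. p * m + k \<in> S} (d k) 0) \<and>
        (\<forall>k<p - 1. near_density {m. p * m + k \<in> S'} (d' k) 0) \<and>
        (\<Sum>k<p - 1. d k) = (\<Sum>k<p - 1. d' k)" if "\<Phi> S S'" for S S'
      using that low sums unfolding \<Phi>_def by blast
  qed
  then show ?thesis by (simp add: Z_def)
qed

section \<open>The prime 2\<close>

lemma trinom_lucas_2:
  shows "odd (central_trinom n)" "even (trinom (2 * m) 1)"
    "even (trinom (2 * m + 1) 1) \<longleftrightarrow> even (s_seq m)"
    "odd (s_seq (2 * m))" "even (s_seq (2 * m + 1)) \<longleftrightarrow> even (trinom m 1)"
proof -
  show odd: "odd (central_trinom n)" for n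
    by (induction n) (simp_all add: trinom_0 central_trinom_Suc)
  have two: "[trinom (2 * m) 2 = trinom m 1] (mod 2)"
    using trinom_mult_prime_cong[of 2 m 2] by simp
  show one: "even (trinom (2 * m) 1)"
    using trinom_mult_prime_cong[of 2 m 1] by (simp add: cong_def even_iff_mod_2_eq_zero)
  have Suc: "trinom (2 * m + 1) 1 = central_trinom (2 * m) + trinom (2 * m) 1 + trinom (2 * m) 2"
    using trinom_Suc[of "2 * m" 1] by simp
  have two': "even (trinom (2 * m) 2) \<longleftrightarrow> even (trinom m 1)"
    using two by (rule cong_dvd_iff)
  show "even (trinom (2 * m + 1) 1) \<longleftrightarrow> even (s_seq m)"
    using odd[of "2 * m"] odd[of m] one two' unfolding Suc s_seq_eq by simp
  show "odd (s_seq (2 * m))" using odd[of "2 * m"] one by (simp add: s_seq_eq)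
  show "even (s_seq (2 * m + 1)) \<longleftrightarrow> even (trinom m 1)"
    using odd[of "2 * m"] odd[of "2 * m + 1"] one two' unfolding s_seq_eq Suc by simp
qed

text \<open>The even sections of \<open>A\<close> and \<open>B\<close> are trivial, and the odd
  sections exchange the two sets. Since only existence is wanted, the family consists of diagonal
  pairs.\<close>

lemma density_even_s_seq: "\<exists>d. has_asymptotic_density {n. even (s_seq n)} d"
proof -
  define A B where "A = {n. even (s_seq n)}" and "B = {n. even (trinom n 1)}"
  have sections: "{m. 2 * m \<in> A} = {}" "{m. Suc (2 * m) \<in> A} = B"
    "{m. 2 * m \<in> B} = UNIV" "{m. Suc (2 * m) \<in> B} = A"
    using trinom_lucas_2 unfolding A_def B_def by auto
  have "\<exists>d. has_asymptotic_density A d \<and> has_asymptotic_density A d"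
  proof (rule common_density_by_sections[where p = 2 and \<Phi> = "\<lambda>S S'. S = S' \<and> S \<in> {A, B}"])
    show "\<exists>d d'. (\<forall>k<2 - 1. near_density {m. 2 * m + k \<in> S} (d k) 0) \<and>
        (\<forall>k<2 - 1. near_density {m. 2 * m + k \<in> S'} (d' k) 0) \<and>
        (\<Sum>k<2 - 1. d k) = (\<Sum>k<2 - 1. d' k)" if "S = S' \<and> S \<in> {A, B}" for S S'
    proof -
      have "near_density {m. 2 * m \<in> S} (if S = A then 0 else 1) 0"
        using that near_density_empty near_density_UNIV by (auto simp: sections)
      with that show ?thesis by (intro exI[of _ "\<lambda>_. if S = A then 0 else 1"]) auto
    qed
    show "{m. 2 * m + (2 - 1) \<in> S} = {m. 2 * m + (2 - 1) \<in> S'} \<and> {m. 2 * m + (2 - 1) \<in> S} \<in> {A, B}"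
      if "S = S' \<and> S \<in> {A, B}" for S S'
    proof -
      consider "S = A" "S' = A" | "S = B" "S' = B" using \<open>S = S' \<and> S \<in> {A, B}\<close> by blast
      then show ?thesis by cases (simp_all add: sections)
    qed
  qed auto
  then show ?thesis unfolding A_def by blast
qed

theorem corollary17:
  fixes p :: nat
  assumes "prime p"
  shows "\<exists>d. has_value_density (\<lambda>n. s_seq n mod int p) 0 d \<and>
             has_value_density (\<lambda>n. Riordan n mod int p) 0 d"
proof (cases "p = 2")
  case True
  have "even (Riordan n) \<longleftrightarrow> even (s_seq n)" for n by (simp add: s_seq_eq Riordan_eq)
  then show ?thesis
    using density_even_s_seq True by (simp add: has_value_density_def flip: even_iff_mod_2_eq_zero)
next
  case False
  have "\<not> int p dvd 2"
    using assms False primes_dvd_imp_eq[of p 2] by (metis of_nat_dvd_iff of_nat_numeral two_is_prime_nat)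
  then have half: "int p dvd 2 * x \<longleftrightarrow> int p dvd x" for x
    using assms by (simp add: prime_dvd_mult_iff)
  \<comment> \<open>The parameters 1 and -3 have product -3, as the reflection argument
    requires.\<close>
  have "2 * s_seq n = trinom_comb 1 n" "2 * Riordan n = - trinom_comb (- 3) n" for n
    by (simp_all add: s_seq_eq Riordan_eq trinom_comb_def central_trinom_Suc)
  then have "int p dvd s_seq n \<longleftrightarrow> int p dvd trinom_comb 1 n"
    "int p dvd Riordan n \<longleftrightarrow> int p dvd trinom_comb (- 3) n" for n
    by (metis half dvd_minus_iff)+
  then show ?thesis
    using common_density_dvd_trinom_comb[OF assms False, of 1 "-3"]
    by (simp add: has_value_density_def flip: dvd_eq_mod_eq_0)
qed

end
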